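(* Let $\mathcal G=(V,\mathcal E)$ be a finite connected undirected graph with associated directed graph $\mathcal D=(V,\mathcal A)$. Consider the strictly positive real points $P=(P_a)_{a\in\mathcal A}$ of the K-variety of $\mathcal G$, parameterized as $$P_{v\to w}=s(v,w)\prod_{B\colon v\in B,\,w\notin B}t_B\ \prod_{B\colon w\in B,\,v\notin B}t_B^{-1},\qquad (v\to w)\in\mathcal A,\qquad(\ast)$$ with $s(v,w)=s(w,v)>0$ for $\overline{vw}\in\mathcal E$ and $t_B>0$ for $\emptyset\neq B\subsetneq V$, where $B$ ranges over all nonempty proper subsets of $V$. (1) The symmetric parameters $s(e)$, $e\in\mathcal E$, are uniquely determined by $P$ in $(\ast)$. The parameters $t_B$, $\emptyset\neq B\subsetneq V$, are confounded exactly by the kernel of $U^{t}$: two parameter vectors $(s,t)$ and $(s',t')$ give the same $P$ if, and only if, $s=s'$ and $U^{t}(\log t-\log t')=0$, where $\log$ is taken componentwise. (2) Let $\mathcal S$ be a family of nonempty proper subsets of $V$ such that the rows $u(B)$, $B\in\mathcal S$, of $U$ are linearly independent and span the row space of $U$. Then $$P_{v\to w}=s(v,w)\prod_{B\in\mathcal S\colon v\in B,\,w\notin B}t_B\ \prod_{B\in\mathcal S\colon w\in B,\,v\notin B}t_B^{-1},\qquad (v\to w)\in\mathcal A,$$ with $s(v,w)=s(w,v)>0$ for $\overline{vw}\in\mathcal E$ and $t_B>0$ for $B\in\mathcal S$, is an identifiable parameterization of the strictly positive points of the K-variety (each such point is obtained from exactly one $(s,t)$). (3) If $P$ is given by $(\ast)$,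 then the detailed balance equations $\kappa(v)P_{v\to w}=\kappa(w)P_{w\to v}$, $(v\to w)\in\mathcal A$, are verified by $\kappa(v)\propto\prod_{B\colon v\in B}t_B^{-2}$, $v\in V$.
   Context: Each edge $\overline{vw}$ of the finite connected undirected graph $\mathcal G=(V,\mathcal E)$ (no loops) is split into two arcs $v\to w$, $w\to v$, giving the directed graph $\mathcal D=(V,\mathcal A)$. A closed path is a sequence of vertices $\omega=v_0v_1\cdots v_{n-1}v_0$ with consecutive vertices joined by arcs of $\mathcal A$; its reverse is $r(\omega)=v_0v_{n-1}\cdots v_1v_0$. For a path $\omega=a_1\cdots a_n$, $a_k\in\mathcal A$, put $P^\omega=\prod_{k=1}^nP_{a_k}$. The K-ideal of $\mathcal G$ is the ideal of the polynomial ring $k[P_a\colon a\in\mathcal A]$ generated by all binomials $P^\omega-P^{r(\omega)}$, $\omega$ a closed path; the K-variety is its affine variety (here $k=\mathbb R$), i.e. the set of $P\in\mathbb R^{\mathcal A}$ with $P^\omega=P^{r(\omega)}$ for all closed paths $\omega$. For $\emptyset\neq B\subsetneq V$ the cocycle vector $u(B)=(u_a(B)\colon a\in\mathcal A)$ has $u_a(B)=+1$ if $a$ exits from $B$, $-1$ if $a$ enters into $B$, $0$ otherwise. The cocycle matrix is $U=[u_a(B)]_{\emptyset\neq B\subsetneq V,\,a\in\mathcal A}$, with rows $u(B)$; $U^{t}$ is its transpose. For $e=\overline{vw}$, $s(e)=s(v,w)$. *)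

theory Defs
  imports Complex_Main
    "HOL-Library.FuncSet"
    "HOL-Library.Function_Algebras"
    "Graph_Theory.Graph_Theory"
begin

definition ugraph :: "'a set \<Rightarrow> 'a set set \<Rightarrow> bool" where
  "ugraph V E \<longleftrightarrow> finite V \<and> E \<subseteq> {{v, w} | v w. v \<in> V \<and> w \<in> V \<and> v \<noteq> w}"

text \<open>The arc from \<open>v\<close> to \<open>w\<close> is the pair \<open>(v, w)\<close>.\<close>

definition split_graph :: "'a set \<Rightarrow> 'a set set \<Rightarrow> 'a pair_pre_digraph" where
  "split_graph V E = \<lparr> pverts = V, parcs = {(v, w). {v, w} \<in> E} \<rparr>"

abbreviation arcset :: "'a set \<Rightarrow> 'a set set \<Rightarrow> ('a \<times> 'a) set" where
  "arcset V E \<equiv> parcs (split_graph V E)"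

text \<open>
  \<open>Graph_Theory\<close> represents a walk by its list of arcs. The closed walk through
  \<open>v\<^sub>0, v\<^sub>1, \<dots>, v\<^sub>n = v\<^sub>0\<close> is thus \<open>[(v\<^sub>0, v\<^sub>1), \<dots>, (v\<^bsub>n-1\<^esub>, v\<^sub>0)]\<close>; its reverse
  visits the same vertices in the opposite order, so each arc is flipped as well.
\<close>

definition rev_walk :: "('a \<times> 'a) list \<Rightarrow> ('a \<times> 'a) list" where
  "rev_walk p = map prod.swap (rev p)"

definition path_monomial :: "('a \<times> 'a \<Rightarrow> real) \<Rightarrow> ('a \<times> 'a) list \<Rightarrow> real" where
  "path_monomial P p = prod_list (map P p)"

text \<open>
  Points of the real affine space with coordinates indexed by the arcs are extensional
  functions (\<open>undefined\<close> off the arcs), so that equality of points is equality on the arcs.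
  The zero set of an ideal is that of its generators, here the binomials attached to the
  closed walks.
\<close>

definition K_variety :: "'a set \<Rightarrow> 'a set set \<Rightarrow> ('a \<times> 'a \<Rightarrow> real) set" where
  "K_variety V E = {P \<in> arcset V E \<rightarrow>\<^sub>E UNIV.
     \<forall>u p. pre_digraph.awalk (with_proj (split_graph V E)) u p u \<longrightarrow>
       path_monomial P p - path_monomial P (rev_walk p) = 0}"

definition K_variety_pos :: "'a set \<Rightarrow> 'a set set \<Rightarrow> ('a \<times> 'a \<Rightarrow> real) set" where
  "K_variety_pos V E = {P \<in> K_variety V E. \<forall>a \<in> arcset V E. P a > 0}"

definition cuts :: "'a set \<Rightarrow> 'a set set" where
  "cuts V = {B. B \<noteq> {} \<and> B \<subset> V}"

text \<open>
  Vectors indexed by the arcs, for the purposes of linear algebra, are functions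
  vanishing off the arcs.
\<close>

definition cocycle :: "'a set \<Rightarrow> 'a set set \<Rightarrow> 'a set \<Rightarrow> 'a \<times> 'a \<Rightarrow> real" where
  "cocycle V E B a =
     (if a \<notin> arcset V E then 0
      else if fst a \<in> B \<and> snd a \<notin> B then 1
      else if fst a \<notin> B \<and> snd a \<in> B then -1
      else 0)"

text \<open>The product of the transposed cocycle matrix with a vector indexed by the cuts.\<close>

definition cocycle_transpose_mult ::
    "'a set \<Rightarrow> 'a set set \<Rightarrow> ('a set \<Rightarrow> real) \<Rightarrow> 'a \<times> 'a \<Rightarrow> real" where
  "cocycle_transpose_mult V E x a = (\<Sum>B \<in> cuts V. cocycle V E B a * x B)"

interpretation real_fun: vector_space "\<lambda>(c::real) (f :: 'b \<Rightarrow> real) x. c * f x"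
  by unfold_locales (auto simp: fun_eq_iff algebra_simps)

text \<open>
  Injectivity makes this independence of the rows as a family indexed by \<open>S\<close>, not merely
  of the set of their values.
\<close>

definition cocycle_row_basis :: "'a set \<Rightarrow> 'a set set \<Rightarrow> 'a set set \<Rightarrow> bool" where
  "cocycle_row_basis V E S \<longleftrightarrow>
     inj_on (cocycle V E) S \<and>
     real_fun.independent (cocycle V E ` S) \<and>
     real_fun.span (cocycle V E ` S) = real_fun.span (cocycle V E ` cuts V)"

text \<open>
  The symmetric parameter is a function of the undirected edge \<open>{v, w}\<close>, which builds in
  \<open>s(v, w) = s(w, v)\<close>.
\<close>

definition edge_params :: "'a set set \<Rightarrow> ('a set \<Rightarrow> real) set" where
  "edge_params E = E \<rightarrow>\<^sub>E {0<..}"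

definition cut_params :: "'a set set \<Rightarrow> ('a set \<Rightarrow> real) set" where
  "cut_params S = S \<rightarrow>\<^sub>E {0<..}"

definition K_point ::
    "'a set \<Rightarrow> 'a set set \<Rightarrow> 'a set set \<Rightarrow> ('a set \<Rightarrow> real) \<Rightarrow> ('a set \<Rightarrow> real) \<Rightarrow> 'a \<times> 'a \<Rightarrow> real" where
  "K_point V E S s t =
     (\<lambda>(v, w) \<in> arcset V E.
        s {v, w} * (\<Prod>B \<in> {B \<in> S. v \<in> B \<and> w \<notin> B}. t B)
                 * (\<Prod>B \<in> {B \<in> S. w \<in> B \<and> v \<notin> B}. inverse (t B)))"

end

theory Submission
  imports Defs
begin

text \<open>
  Let \<open>d(v, w) = (ln P\<^bsub>v\<rightarrow>w\<^esub> - ln P\<^bsub>w\<rightarrow>v\<^esub>) / 2\<close> be half the antisymmetric part of \<open>ln P\<close>. A positive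
  \<open>P\<close> lies on the K-variety iff \<open>d\<close> sums to zero along every closed walk, which by connectedness
  means that \<open>d(v, w) = \<phi>(v) - \<phi>(w)\<close> for a potential \<open>\<phi>\<close>, that is, \<open>d\<close> is the combination
  \<open>\<Sum>v. \<phi>(v) u({v})\<close> of rows of the cocycle matrix. In the parameterization, \<open>ln s\<close> is the
  symmetric part of \<open>ln P\<close> and \<open>ln t\<close> is the coefficient vector of \<open>d\<close> in the rows \<open>u(B)\<close>.
\<close>

section \<open>Linear combinations of indexed families of functions\<close>

lemma sum_fun_apply:
  "(\<Sum>i\<in>I. f i) x = (\<Sum>i\<in>I. f i x)"
  by (induction I rule: infinite_finite_induct) auto

text \<open>The span of an image yields coefficients indexed by the values of \<open>g\<close>,
  while the parameters are indexed by \<open>S\<close>. As \<open>g\<close> may repeat values, as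
  \<open>cocycle V E\<close> may on all cuts, the coefficient of a value \<open>h\<close> is shared
  equally among the \<open>N h\<close> indices mapped to \<open>h\<close>.\<close>

lemma in_span_image_real_fun:
  fixes g :: "'i \<Rightarrow> 'b \<Rightarrow> real"
  assumes "finite S" and "f \<in> real_fun.span (g ` S)"
  obtains x where "\<And>a. f a = (\<Sum>i\<in>S. x i * g i a)"
proof -
  obtain c where c: "f = (\<Sum>h\<in>g ` S. (\<lambda>a. c h * h a))"
    using assms by (auto simp: real_fun.span_finite)
  define N where "N h = real (card {i \<in> S. g i = h})" for h
  have "f a = (\<Sum>i\<in>S. c (g i) / N (g i) * g i a)" for a
  proof -
    have "(\<Sum>i\<in>S. c (g i) / N (g i) * g i a)
        = (\<Sum>h\<in>g ` S. \<Sum>i\<in>{i \<in> S. g i = h}. c (g i) / N (g i) * g i a)"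
      by (rule sum.image_gen[OF assms(1)])
    also have "\<dots> = (\<Sum>h\<in>g ` S. c h * h a)"
    proof (rule sum.cong[OF refl])
      fix h assume "h \<in> g ` S"
      then have "N h \<noteq> 0"
        using assms(1) by (auto simp: N_def)
      then show "(\<Sum>i\<in>{i \<in> S. g i = h}. c (g i) / N (g i) * g i a) = c h * h a"
        by (simp add: N_def)
    qed
    finally show ?thesis
      by (simp add: c sum_fun_apply)
  qed
  then show thesis by (rule that)
qed

lemma real_fun_independent_imageD:
  fixes g :: "'i \<Rightarrow> 'b \<Rightarrow> real"
  assumes "finite S" "inj_on g S" "real_fun.independent (g ` S)"
    and "\<And>a. (\<Sum>i\<in>S. x i * g i a) = 0" and "i \<in> S"
  shows "x i = 0"
proof -
  have "(\<Sum>h\<in>g ` S. (\<lambda>a. x (the_inv_into S g h) * h a)) = 0"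
    using assms(2,4) by (auto simp: fun_eq_iff sum_fun_apply sum.reindex the_inv_into_f_f)
  then have "x (the_inv_into S g (g i)) = 0"
    using assms(1,3,5) real_fun.independentD[of "g ` S" "g ` S" "\<lambda>h. x (the_inv_into S g h)" "g i"]
    by auto
  then show ?thesis
    using assms(2,5) by (simp add: the_inv_into_f_f)
qed

section \<open>Logarithms of path monomials\<close>

text \<open>Multiplication commutes, so the order of the arcs is lost and only their flipping
  remains.\<close>

lemma path_monomial_rev_walk:
  "path_monomial P (rev_walk p) = path_monomial (P \<circ> prod.swap) p"
  by (induction p) (simp_all add: path_monomial_def rev_walk_def mult.commute)

lemma path_monomial_pos:
  "(\<And>a. a \<in> set p \<Longrightarrow> P a > 0) \<Longrightarrow> path_monomial P p > 0"
  by (induction p) (simp_all add: path_monomial_def)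

lemma ln_path_monomial:
  "(\<And>a. a \<in> set p \<Longrightarrow> P a > 0) \<Longrightarrow> ln (path_monomial P p) = (\<Sum>a\<leftarrow>p. ln (P a))"
proof (induction p)
  case (Cons a p)
  have "path_monomial P p > 0"
    by (rule path_monomial_pos) (simp add: Cons.prems)
  moreover have "path_monomial P (a # p) = P a * path_monomial P p"
    by (simp add: path_monomial_def)
  moreover have "P a > 0"
    by (simp add: Cons.prems)
  ultimately show ?case
    using Cons by (simp add: ln_mult_pos)
qed (simp add: path_monomial_def)

text \<open>The function \<open>d\<close> of the overview. Since \<open>ln\<close> is total, its
  antisymmetry holds on all pairs, with no positivity assumption.\<close>

definition half_log_ratio :: "('a \<times> 'a \<Rightarrow> real) \<Rightarrow> 'a \<times> 'a \<Rightarrow> real" where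
  "half_log_ratio P a = (ln (P a) - ln (P (prod.swap a))) / 2"

lemma half_log_ratio_swap: "half_log_ratio P (prod.swap a) = - half_log_ratio P a"
  by (simp add: half_log_ratio_def field_simps)

lemma sum_half_log_ratio_rev_walk:
  "(\<Sum>a\<leftarrow>rev_walk p. half_log_ratio P a) = - (\<Sum>a\<leftarrow>p. half_log_ratio P a)"
  by (induction p) (simp_all add: rev_walk_def half_log_ratio_swap)

text \<open>The sum is half the difference of the logarithms of the two monomials, and
  \<open>ln\<close> is injective on positive reals. This makes the binomial equations
  linear.\<close>

lemma path_monomial_eq_rev_walk_iff:
  assumes "\<And>a. a \<in> set p \<Longrightarrow> P a > 0 \<and> P (prod.swap a) > 0"
  shows "path_monomial P p = path_monomial P (rev_walk p)
    \<longleftrightarrow> (\<Sum>a\<leftarrow>p. half_log_ratio P a) = 0"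
proof -
  have pos: "path_monomial P p > 0" "path_monomial (P \<circ> prod.swap) p > 0"
    using assms by (auto intro!: path_monomial_pos)
  have "(\<Sum>a\<leftarrow>p. half_log_ratio P a)
      = ((\<Sum>a\<leftarrow>p. ln (P a)) - (\<Sum>a\<leftarrow>p. ln (P (prod.swap a)))) / 2"
    by (induction p) (simp_all add: half_log_ratio_def field_simps)
  also have "\<dots> = (ln (path_monomial P p) - ln (path_monomial (P \<circ> prod.swap) p)) / 2"
    using assms by (simp add: ln_path_monomial)
  finally have "(\<Sum>a\<leftarrow>p. half_log_ratio P a) = 0 \<longleftrightarrow>
      ln (path_monomial P p) = ln (path_monomial (P \<circ> prod.swap) p)"
    by auto
  then show ?thesis
    using pos by (simp add: path_monomial_rev_walk)
qed

section \<open>Arcs and walks of a connected graph\<close>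

locale connected_split_graph =
  fixes V :: "'a set" and E :: "'a set set"
  assumes ugraph: "ugraph V E"
    and connected: "Digraph_Component.connected (with_proj (split_graph V E))"
begin

lemma finite_V: "finite V"
  using ugraph by (simp add: ugraph_def)

lemma finite_cuts: "finite (cuts V)"
  using finite_V by (auto simp: cuts_def intro: finite_subset[of _ "Pow V"])

lemma arc_iff: "(v, w) \<in> arcset V E \<longleftrightarrow> {v, w} \<in> E"
  by (simp add: split_graph_def)

lemma arcD:
  assumes "(v, w) \<in> arcset V E"
  shows "v \<in> V" "w \<in> V" "v \<noteq> w" "(w, v) \<in> arcset V E" "{v, w} \<in> E"
proof -
  show e: "{v, w} \<in> E"
    using assms by (simp add: arc_iff)
  then obtain v' w' where "{v, w} = {v', w'}" "v' \<in> V" "w' \<in> V" "v' \<noteq> w'"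
    using ugraph unfolding ugraph_def by blast
  then show "v \<in> V" "w \<in> V" "v \<noteq> w"
    by (auto simp: doubleton_eq_iff)
  show "(w, v) \<in> arcset V E"
    using e by (simp add: arc_iff insert_commute)
qed

lemma swap_arc: "a \<in> arcset V E \<Longrightarrow> prod.swap a \<in> arcset V E"
  using arcD(4) by (cases a) simp

lemma edgeE:
  assumes "e \<in> E"
  obtains v w where "e = {v, w}" "(v, w) \<in> arcset V E"
  using assms ugraph by (auto simp: ugraph_def arc_iff)

lemma pair_wf: "pair_wf_digraph (split_graph V E)"
proof
  fix a assume "a \<in> arcset V E"
  then show "fst a \<in> pverts (split_graph V E)" "snd a \<in> pverts (split_graph V E)"
    using arcD(1,2)[of "fst a" "snd a"] by (simp_all add: split_graph_def)
qed

sublocale pair_wf_digraph "split_graph V E"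
  by (rule pair_wf)

lemma verts_split_graph: "pverts (split_graph V E) = V"
  by (simp add: split_graph_def)

text \<open>Connectedness means strong connectedness of the symmetric closure; the split graph is
  symmetric already and equals that closure.\<close>

lemma awalk_exists:
  assumes "u \<in> V" "v \<in> V"
  obtains p where "awalk u p v"
proof -
  have "mk_symmetric (with_proj (split_graph V E)) = split_graph V E"
    by (rule pair_pre_digraph.equality) (use swap_arc in \<open>force simp: parcs_mk_symmetric\<close>)+
  then have "u \<rightarrow>\<^sup>*\<^bsub>with_proj (split_graph V E)\<^esub> v"
    using connected assms
    by (auto simp: Digraph_Component.connected_def strongly_connected_def verts_split_graph)
  then show thesis
    using that by (auto simp: reachable_awalk)
qed

lemma awalk_rev_walk: "awalk u p v \<Longrightarrow> awalk v (rev_walk p) u"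
proof (induction p arbitrary: u)
  case Nil
  then show ?case by (auto simp: rev_walk_def awalk_Nil_iff)
next
  case (Cons a p)
  then have a: "a \<in> arcset V E" "u = fst a" and "awalk (snd a) p v"
    by (auto simp: awalk_Cons_iff)
  then have "awalk v (rev_walk p) (snd a)"
    using Cons.IH by blast
  moreover have "awalk (snd a) [prod.swap a] (fst a)"
    using swap_arc[OF a(1)] arcD(1,2)[of "fst a" "snd a"] a(1)
    by (simp add: awalk_simps verts_split_graph)
  ultimately show ?case
    using a by (simp add: rev_walk_def)
qed

lemma sum_awalk_telescope:
  fixes \<phi> :: "'a \<Rightarrow> real"
  assumes "awalk u p v" and "\<And>v w. (v, w) \<in> arcset V E \<Longrightarrow> d (v, w) = \<phi> v - \<phi> w"
  shows "(\<Sum>a\<leftarrow>p. d a) = \<phi> u - \<phi> v"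
  using assms(1)
proof (induction p arbitrary: u)
  case (Cons a p)
  then show ?case
    using assms(2)[of "fst a" "snd a"] by (auto simp: awalk_Cons_iff)
qed (simp add: awalk_Nil_iff)

section \<open>Positive points of the K-variety and potentials\<close>

text \<open>A discrete Poincare lemma: differences of a potential telescope to zero along closed
  walks; conversely, vanishing on closed walks allows integration from a fixed root.\<close>

lemma K_variety_pos_iff:
  "P \<in> K_variety_pos V E \<longleftrightarrow>
     P \<in> arcset V E \<rightarrow>\<^sub>E {0<..} \<and>
     (\<exists>\<phi>. \<forall>(v, w) \<in> arcset V E. half_log_ratio P (v, w) = \<phi> v - \<phi> w)"
proof -
  have "(\<forall>u p. awalk u p u \<longrightarrow> path_monomial P p - path_monomial P (rev_walk p) = 0) \<longleftrightarrow>
      (\<exists>\<phi>. \<forall>(v, w) \<in> arcset V E. half_log_ratio P (v, w) = \<phi> v - \<phi> w)" (is "?K \<longleftrightarrow> ?\<phi>")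
    if pos: "\<forall>a \<in> arcset V E. P a > 0"
  proof -
    have "(path_monomial P p - path_monomial P (rev_walk p) = 0) \<longleftrightarrow>
        (\<Sum>a\<leftarrow>p. half_log_ratio P a) = 0" if "awalk u p u" for u p
    proof -
      have "set p \<subseteq> arcset V E"
        using that by (auto simp: awalk_def)
      then show ?thesis
        using pos swap_arc by (subst path_monomial_eq_rev_walk_iff[symmetric]) auto
    qed
    then have "?K \<longleftrightarrow> (\<forall>u p. awalk u p u \<longrightarrow> (\<Sum>a\<leftarrow>p. half_log_ratio P a) = 0)"
      by blast
    also have "\<dots> \<longleftrightarrow> ?\<phi>"
    proof
      assume "?\<phi>"
      then obtain \<phi> where "\<And>v w. (v, w) \<in> arcset V E \<Longrightarrow> half_log_ratio P (v, w) = \<phi> v - \<phi> w"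
        by blast
      then show "\<forall>u p. awalk u p u \<longrightarrow> (\<Sum>a\<leftarrow>p. half_log_ratio P a) = 0"
        using sum_awalk_telescope[of _ _ _ "half_log_ratio P" \<phi>] by auto
    next
      assume closed: "\<forall>u p. awalk u p u \<longrightarrow> (\<Sum>a\<leftarrow>p. half_log_ratio P a) = 0"
      \<comment> \<open>Connectedness includes that the vertex set is nonempty, which provides the
        root.\<close>
      obtain r where r: "r \<in> V"
        using connected
        by (auto simp: Digraph_Component.connected_def strongly_connected_def verts_split_graph)
      then have "\<forall>v\<in>V. \<exists>p. awalk r p v"
        by (blast intro: awalk_exists)
      then obtain W where W: "\<And>v. v \<in> V \<Longrightarrow> awalk r (W v) v"
        by metis
      \<comment> \<open>The minus sign fits the convention that an arc carries the potential of its
        tail minus that of its head.\<close>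
      define \<phi> where "\<phi> v = - (\<Sum>a\<leftarrow>W v. half_log_ratio P a)" for v
      have "half_log_ratio P (v, w) = \<phi> v - \<phi> w" if vw: "(v, w) \<in> arcset V E" for v w
      proof -
        have "awalk v [(v, w)] w"
          using vw by (auto simp: awalk_simps verts_split_graph dest: arcD)
        \<comment> \<open>Going from the root to \<open>v\<close>, across the arc, and back from
          \<open>w\<close> gives the sum \<open>- \<phi> v + d(v, w) + \<phi> w\<close>, where
          \<open>d\<close> is \<open>half_log_ratio P\<close>.\<close>
        then have "awalk r (W v @ [(v, w)] @ rev_walk (W w)) r"
          using W arcD(1,2)[OF vw] by (blast intro: awalk_appendI awalk_rev_walk)
        then have "(\<Sum>a\<leftarrow>W v @ [(v, w)] @ rev_walk (W w). half_log_ratio P a) = 0"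
          using closed by blast
        then show ?thesis
          by (simp add: \<phi>_def sum_half_log_ratio_rev_walk)
      qed
      then show "?\<phi>"
        by blast
    qed
    finally show ?thesis .
  qed
  then have "P \<in> K_variety_pos V E \<longleftrightarrow> P \<in> arcset V E \<rightarrow>\<^sub>E UNIV \<and> (\<forall>a \<in> arcset V E. P a > 0) \<and>
      (\<exists>\<phi>. \<forall>(v, w) \<in> arcset V E. half_log_ratio P (v, w) = \<phi> v - \<phi> w)"
    unfolding K_variety_pos_def K_variety_def mem_Collect_eq by meson
  moreover have "P \<in> arcset V E \<rightarrow>\<^sub>E {0<..} \<longleftrightarrow>
      P \<in> arcset V E \<rightarrow>\<^sub>E UNIV \<and> (\<forall>a \<in> arcset V E. P a > 0)"
    by (simp add: PiE_iff conj_commute)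
  ultimately show ?thesis
    by (simp only: conj_assoc)
qed

section \<open>The parameterization in exponential form, for a finite family of sets\<close>

text \<open>On an arc, the cocycle of \<open>B\<close> is the indicator of \<open>B\<close> at the
  tail minus that at the head. So every combination of rows comes from a potential.\<close>

lemma cocycle_sum_eq_potential_diff:
  assumes "finite S" "(v, w) \<in> arcset V E"
  shows "(\<Sum>B\<in>S. cocycle V E B (v, w) * x B)
    = (\<Sum>B\<in>{B \<in> S. v \<in> B}. x B) - (\<Sum>B\<in>{B \<in> S. w \<in> B}. x B)"
proof -
  have "(\<Sum>B\<in>S. cocycle V E B (v, w) * x B)
      = (\<Sum>B\<in>S. (if v \<in> B then x B else 0) - (if w \<in> B then x B else 0))"
    by (rule sum.cong) (use assms in \<open>auto simp: cocycle_def\<close>)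
  then show ?thesis
    using assms(1) by (simp only: sum_subtractf sum.inter_filter)
qed

lemma K_point_eq_exp:
  assumes "finite S" "t \<in> cut_params S" "(v, w) \<in> arcset V E"
  shows "K_point V E S s t (v, w)
    = s {v, w} * exp (\<Sum>B\<in>S. cocycle V E B (v, w) * ln (t B))"
proof -
  have pos: "t B > 0" if "B \<in> S" for B
    using assms(2) that by (auto simp: cut_params_def)
  have "exp (\<Sum>B\<in>S. cocycle V E B (v, w) * ln (t B))
      = (\<Prod>B\<in>S. exp (cocycle V E B (v, w) * ln (t B)))"
    using assms(1) by (rule exp_sum)
  also have "\<dots> = (\<Prod>B\<in>S. (if v \<in> B \<and> w \<notin> B then t B else 1) *
      (if w \<in> B \<and> v \<notin> B then inverse (t B) else 1))"
    by (rule prod.cong) (use assms(3) pos in \<open>auto simp: cocycle_def exp_minus\<close>)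
  also have "\<dots> = (\<Prod>B\<in>{B \<in> S. v \<in> B \<and> w \<notin> B}. t B) *
      (\<Prod>B\<in>{B \<in> S. w \<in> B \<and> v \<notin> B}. inverse (t B))"
    using assms(1) by (simp only: prod.distrib prod.inter_filter)
  finally have *: "exp (\<Sum>B\<in>S. cocycle V E B (v, w) * ln (t B)) = \<dots>" .
  have "K_point V E S s t (v, w) = s {v, w} * (\<Prod>B\<in>{B \<in> S. v \<in> B \<and> w \<notin> B}. t B) *
      (\<Prod>B\<in>{B \<in> S. w \<in> B \<and> v \<notin> B}. inverse (t B))"
    using assms(3) by (simp add: K_point_def)
  then show ?thesis
    by (simp only: * mult.assoc)
qed

lemma cocycle_sum_swap:
  assumes "finite S" "(v, w) \<in> arcset V E"
  shows "(\<Sum>B\<in>S. cocycle V E B (w, v) * x B) = - (\<Sum>B\<in>S. cocycle V E B (v, w) * x B)"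
  using assms arcD(4)[OF assms(2)] by (simp add: cocycle_sum_eq_potential_diff)

lemma K_point_extensional: "K_point V E S s t \<in> extensional (arcset V E)"
  by (simp add: K_point_def)

lemma edge_params_pos: "s \<in> edge_params E \<Longrightarrow> (v, w) \<in> arcset V E \<Longrightarrow> s {v, w} > 0"
  by (auto simp: edge_params_def arc_iff)

text \<open>The factor \<open>s {v, w}\<close> is common to both orientations and cancels, while the
  exponent changes sign. This isolates \<open>t\<close> from \<open>s\<close>.\<close>

lemma half_log_ratio_K_point:
  assumes "finite S" "s \<in> edge_params E" "t \<in> cut_params S" "(v, w) \<in> arcset V E"
  shows "half_log_ratio (K_point V E S s t) (v, w) = (\<Sum>B\<in>S. cocycle V E B (v, w) * ln (t B))"
  using assms arcD(4)[OF assms(4)] edge_params_pos[OF assms(2,4)]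
  by (simp add: half_log_ratio_def K_point_eq_exp cocycle_sum_swap[OF assms(1,4)] ln_mult_pos
      insert_commute[of w v])

text \<open>The opposite exponents cancel, so \<open>s\<close> can be read off from the point
  alone.\<close>

lemma K_point_mult_swap:
  assumes "finite S" "t \<in> cut_params S" "(v, w) \<in> arcset V E"
  shows "K_point V E S s t (v, w) * K_point V E S s t (w, v) = (s {v, w})\<^sup>2"
  using assms arcD(4)[OF assms(3)]
  by (simp add: K_point_eq_exp cocycle_sum_swap[OF assms(1,3)] insert_commute[of w v] exp_minus
      power2_eq_square)

lemma K_point_in_K_variety_pos:
  assumes "finite S" "s \<in> edge_params E" "t \<in> cut_params S"
  shows "K_point V E S s t \<in> K_variety_pos V E"
proof -
  have "K_point V E S s t (v, w) > 0" if "(v, w) \<in> arcset V E" for v w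
    using assms that by (simp add: K_point_eq_exp edge_params_pos)
  then have "K_point V E S s t \<in> arcset V E \<rightarrow>\<^sub>E {0<..}"
    using K_point_extensional by (auto simp: PiE_iff)
  moreover have "half_log_ratio (K_point V E S s t) (v, w)
      = (\<Sum>B\<in>{B \<in> S. v \<in> B}. ln (t B)) - (\<Sum>B\<in>{B \<in> S. w \<in> B}. ln (t B))"
    if "(v, w) \<in> arcset V E" for v w
    using assms that by (simp add: half_log_ratio_K_point cocycle_sum_eq_potential_diff)
  ultimately show ?thesis
    unfolding K_variety_pos_iff
    by (intro conjI exI[of _ "\<lambda>v. \<Sum>B\<in>{B \<in> S. v \<in> B}. ln (t B)"]) auto
qed

text \<open>The product over both orientations of an edge recovers \<open>s\<close>, and the half
  log ratio recovers the image of \<open>ln t\<close> under the transposed matrix with rows in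
  \<open>S\<close>. These two data in turn determine the point by its exponential form.\<close>

lemma K_point_eq_iff:
  assumes "finite S" "s \<in> edge_params E" "s' \<in> edge_params E"
    and "t \<in> cut_params S" "t' \<in> cut_params S"
  shows "K_point V E S s t = K_point V E S s' t' \<longleftrightarrow>
    s = s' \<and> (\<forall>a \<in> arcset V E. (\<Sum>B\<in>S. cocycle V E B a * (ln (t B) - ln (t' B))) = 0)"
    (is "?P = ?P' \<longleftrightarrow> _")
proof
  assume eq: "?P = ?P'"
  have "s e = s' e" if e: "e \<in> E" for e
  proof -
    obtain v w where vw: "e = {v, w}" "(v, w) \<in> arcset V E"
      by (rule edgeE[OF e])
    then have "(s {v, w})\<^sup>2 = (s' {v, w})\<^sup>2"
      using K_point_mult_swap[OF assms(1,4) vw(2), of s] K_point_mult_swap[OF assms(1,5) vw(2), of s']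
      by (simp add: eq)
    \<comment> \<open>Equal squares leave a choice of sign, which positivity settles.\<close>
    then show ?thesis
      using vw edge_params_pos[OF assms(2) vw(2)] edge_params_pos[OF assms(3) vw(2)]
      by (simp add: power2_eq_iff)
  qed
  then have "s = s'"
    using assms(2,3) unfolding edge_params_def by (intro PiE_ext) auto
  moreover have "(\<Sum>B\<in>S. cocycle V E B a * (ln (t B) - ln (t' B))) = 0" if "a \<in> arcset V E" for a
    using half_log_ratio_K_point[OF assms(1,2,4), of "fst a" "snd a"]
      half_log_ratio_K_point[OF assms(1,3,5), of "fst a" "snd a"] that eq
    by (simp add: right_diff_distrib sum_subtractf)
  ultimately show "s = s' \<and>
      (\<forall>a \<in> arcset V E. (\<Sum>B\<in>S. cocycle V E B a * (ln (t B) - ln (t' B))) = 0)"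
    by blast
next
  assume *: "s = s' \<and>
    (\<forall>a \<in> arcset V E. (\<Sum>B\<in>S. cocycle V E B a * (ln (t B) - ln (t' B))) = 0)"
  show "?P = ?P'"
  proof (rule extensionalityI[OF K_point_extensional K_point_extensional])
    fix a assume "a \<in> arcset V E"
    then show "?P a = ?P' a"
      using * assms by (cases a) (simp add: K_point_eq_exp right_diff_distrib sum_subtractf)
  qed
qed

section \<open>Every positive point of the K-variety is parameterized\<close>

text \<open>A potential \<phi> is realized by the cocycles of singletons with coefficients
  \<open>\<phi> v\<close>. The function is cut off to zero outside the arcs, as the rows
  are.\<close>

lemma half_log_ratio_in_cocycle_span:
  assumes "P \<in> K_variety_pos V E"
  shows "(\<lambda>a. if a \<in> arcset V E then half_log_ratio P a else 0)
    \<in> real_fun.span (cocycle V E ` cuts V)"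
proof -
  obtain \<phi> where \<phi>: "\<And>v w. (v, w) \<in> arcset V E \<Longrightarrow> half_log_ratio P (v, w) = \<phi> v - \<phi> w"
    using assms unfolding K_variety_pos_iff by blast
  have "(\<lambda>a. if a \<in> arcset V E then half_log_ratio P a else 0)
      = (\<Sum>v\<in>V. (\<lambda>a. \<phi> v * cocycle V E {v} a))" (is "?d = ?c")
  proof
    fix a :: "'a \<times> 'a"
    obtain v w where a: "a = (v, w)"
      by (cases a)
    show "?d a = ?c a"
    proof (cases "a \<in> arcset V E")
      case True
      then have vw: "(v, w) \<in> arcset V E"
        by (simp add: a)
      \<comment> \<open>Only the singletons of the two endpoints contribute, with opposite signs;
        the endpoints differ as there are no loops.\<close>
      have "(\<Sum>z\<in>V. \<phi> z * cocycle V E {z} (v, w))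
          = (\<Sum>z\<in>V. (if z = v then \<phi> z else 0) - (if z = w then \<phi> z else 0))"
        using arcD(3)[OF vw] vw by (intro sum.cong) (auto simp: cocycle_def)
      also have "\<dots> = \<phi> v - \<phi> w"
        using arcD(1,2)[OF vw] finite_V by (simp add: sum_subtractf)
      finally show ?thesis
        using vw by (simp add: a \<phi> sum_fun_apply)
    qed (simp add: cocycle_def sum_fun_apply)
  qed
  moreover have "?c \<in> real_fun.span (cocycle V E ` cuts V)"
  proof (rule real_fun.span_sum)
    fix v assume v: "v \<in> V"
    show "(\<lambda>a. \<phi> v * cocycle V E {v} a) \<in> real_fun.span (cocycle V E ` cuts V)"
    proof (cases "V = {v}")
      case True
      \<comment> \<open>Here \<open>{v}\<close> is not a cut, but there are no arcs either.\<close>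
      then have "arcset V E = {}"
        using arcD(1,2,3) by fast
      then have "(\<lambda>a. \<phi> v * cocycle V E {v} a) = 0"
        by (auto simp: cocycle_def)
      then show ?thesis
        by (simp only: real_fun.span_zero)
    next
      case False
      then have "{v} \<in> cuts V"
        using v by (auto simp: cuts_def)
      then show ?thesis
        by (intro real_fun.span_scale real_fun.span_base) simp
    qed
  qed
  ultimately show ?thesis
    by simp
qed

text \<open>Write \<open>P a\<close> as \<open>sqrt (P a * P a') * sqrt (P a / P a')\<close> with
  \<open>a'\<close> the reversed arc. The first factor is symmetric and serves as \<open>s\<close>;
  the second is the exponential of \<open>half_log_ratio P a\<close>, whose coefficients in the rows
  give \<open>ln t\<close>.\<close>

lemma K_variety_pos_subset_image_K_point:
  assumes "finite S"
    and span: "real_fun.span (cocycle V E ` S) = real_fun.span (cocycle V E ` cuts V)"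
    and P: "P \<in> K_variety_pos V E"
  shows "\<exists>s \<in> edge_params E. \<exists>t \<in> cut_params S. P = K_point V E S s t"
proof -
  have PiE: "P \<in> arcset V E \<rightarrow>\<^sub>E {0<..}"
    using P by (simp add: K_variety_pos_iff)
  then have pos: "P a > 0" if "a \<in> arcset V E" for a
    using that by (auto simp: PiE_iff)
  have "(\<lambda>a. if a \<in> arcset V E then half_log_ratio P a else 0)
      \<in> real_fun.span (cocycle V E ` S)"
    using half_log_ratio_in_cocycle_span[OF P] by (simp only: span)
  then obtain x where d: "\<And>a. (if a \<in> arcset V E then half_log_ratio P a else 0)
      = (\<Sum>B\<in>S. x B * cocycle V E B a)"
    using in_span_image_real_fun[OF assms(1)] by blast
  then have x: "half_log_ratio P a = (\<Sum>B\<in>S. cocycle V E B a * x B)" if "a \<in> arcset V E" for a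
    using d[of a] that by (simp add: mult.commute)
  define t where "t = (\<lambda>B\<in>S. exp (x B))"
  \<comment> \<open>The product runs over the two arcs of \<open>e\<close>, which avoids choosing an
    orientation.\<close>
  define s where "s = (\<lambda>e\<in>E. sqrt (\<Prod>a\<in>{a \<in> arcset V E. {fst a, snd a} = e}. P a))"
  have t: "t \<in> cut_params S"
    by (simp add: t_def cut_params_def)
  have s: "s \<in> edge_params E"
    using pos by (auto simp: s_def edge_params_def intro!: prod_pos)
  have s_arc: "s {v, w} = sqrt (P (v, w) * P (w, v))" if vw: "(v, w) \<in> arcset V E" for v w
  proof -
    have "{a \<in> arcset V E. {fst a, snd a} = {v, w}} = {(v, w), (w, v)}"
      using arcD(4)[OF vw] vw by (auto simp: doubleton_eq_iff)
    then show ?thesis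
      using arcD(3,5)[OF vw] by (simp add: s_def)
  qed
  have "P = K_point V E S s t"
  proof (rule extensionalityI[OF _ K_point_extensional])
    show "P \<in> extensional (arcset V E)"
      using PiE by (simp add: PiE_iff)
    fix a assume a: "a \<in> arcset V E"
    obtain v w where vw: "a = (v, w)"
      by (cases a)
    have p: "P (v, w) > 0" "P (w, v) > 0"
      using a pos arcD(4) by (auto simp: vw)
    have "K_point V E S s t a = sqrt (P (v, w) * P (w, v)) * exp (half_log_ratio P a)"
      using a t assms(1) by (simp add: vw K_point_eq_exp s_arc x t_def)
    also have "exp (half_log_ratio P a) = sqrt (P (v, w) / P (w, v))"
    proof -
      have "half_log_ratio P a = ln (sqrt (P (v, w) / P (w, v)))"
        using p by (simp add: vw half_log_ratio_def ln_sqrt ln_div)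
      then show ?thesis
        using p by simp
    qed
    also have "sqrt (P (v, w) * P (w, v)) * sqrt (P (v, w) / P (w, v)) = P a"
      using p by (simp add: vw real_sqrt_mult[symmetric])
    finally show "P a = K_point V E S s t a" ..
  qed
  then show ?thesis
    using s t by blast
qed

lemma image_K_point:
  assumes "finite S" "real_fun.span (cocycle V E ` S) = real_fun.span (cocycle V E ` cuts V)"
  shows "(\<lambda>(s, t). K_point V E S s t) ` (edge_params E \<times> cut_params S) = K_variety_pos V E"
  using K_point_in_K_variety_pos[OF assms(1)] K_variety_pos_subset_image_K_point[OF assms]
  by (auto simp: image_iff)

section \<open>Identifiability for a row basis, and detailed balance\<close>

text \<open>Spanning gives surjectivity. Independence makes the kernel that confounds the
  \<open>t B\<close> trivial, so \<open>ln t\<close>, and with it \<open>t\<close>, is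
  unique.\<close>

lemma bij_betw_K_point:
  assumes "S \<subseteq> cuts V" "cocycle_row_basis V E S"
  shows "bij_betw (\<lambda>(s, t). K_point V E S s t) (edge_params E \<times> cut_params S) (K_variety_pos V E)"
proof -
  have fin: "finite S"
    using assms(1) finite_cuts by (rule finite_subset)
  have "s = s' \<and> t = t'"
    if s: "s \<in> edge_params E" "s' \<in> edge_params E" and t: "t \<in> cut_params S" "t' \<in> cut_params S"
      and eq: "K_point V E S s t = K_point V E S s' t'" for s s' t t'
  proof -
    have *: "s = s'"
        "\<And>a. a \<in> arcset V E \<Longrightarrow> (\<Sum>B\<in>S. cocycle V E B a * (ln (t B) - ln (t' B))) = 0"
      using eq K_point_eq_iff[OF fin s t] by auto
    \<comment> \<open>Independence concerns functions on all pairs, so the relation is extended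
      beyond the arcs, where cocycles vanish.\<close>
    have zero: "(\<Sum>B\<in>S. (ln (t B) - ln (t' B)) * cocycle V E B a) = 0" for a
    proof (cases "a \<in> arcset V E")
      case True
      then show ?thesis
        using *(2) by (simp add: mult.commute)
    qed (simp add: cocycle_def)
    have "t B = t' B" if B: "B \<in> S" for B
    proof -
      have "ln (t B) - ln (t' B) = 0"
        using real_fun_independent_imageD[where g = "cocycle V E", OF fin _ _ zero B] assms(2)
        by (simp add: cocycle_row_basis_def)
      then show ?thesis
        using t B by (auto simp: cut_params_def PiE_iff)
    qed
    then have "t = t'"
      using t unfolding cut_params_def by (intro PiE_ext) auto
    with *(1) show ?thesis
      by blast
  qed
  then have "inj_on (\<lambda>(s, t). K_point V E S s t) (edge_params E \<times> cut_params S)"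
    by (auto simp: inj_on_def)
  moreover have "real_fun.span (cocycle V E ` S) = real_fun.span (cocycle V E ` cuts V)"
    using assms(2) by (simp add: cocycle_row_basis_def)
  ultimately show ?thesis
    using image_K_point[OF fin] by (simp add: bij_betw_def)
qed

text \<open>With \<phi> the potential of \<open>ln t\<close>, the weight at \<open>v\<close> is
  \<open>exp (- 2 * \<phi> v)\<close> and the point is
  \<open>s {v, w} * exp (\<phi> v - \<phi> w)\<close>. Both sides thus equal
  \<open>s {v, w} * exp (- \<phi> v - \<phi> w)\<close>.\<close>

lemma detailed_balance:
  assumes "finite S" "t \<in> cut_params S" "(v, w) \<in> arcset V E"
  shows "(\<Prod>B\<in>{B \<in> S. v \<in> B}. t B powi (-2)) * K_point V E S s t (v, w)
    = (\<Prod>B\<in>{B \<in> S. w \<in> B}. t B powi (-2)) * K_point V E S s t (w, v)"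
proof -
  define \<phi> where "\<phi> v = (\<Sum>B\<in>{B \<in> S. v \<in> B}. ln (t B))" for v
  have k: "(\<Prod>B\<in>{B \<in> S. v \<in> B}. t B powi (-2)) = exp (- 2 * \<phi> v)" for v
  proof -
    have "t B powi (-2) = exp (- 2 * ln (t B))" if "B \<in> S" for B
    proof -
      have "t B > 0"
        using assms(2) that by (auto simp: cut_params_def)
      then show ?thesis
        by (simp add: power_int_minus exp_minus exp_double)
    qed
    then show ?thesis
      using assms(1) by (simp add: \<phi>_def sum_distrib_left exp_sum flip: sum_negf)
  qed
  have P: "K_point V E S s t (v, w) = s {v, w} * exp (\<phi> v - \<phi> w)"
      "K_point V E S s t (w, v) = s {v, w} * exp (\<phi> w - \<phi> v)"
    using assms arcD(4)[OF assms(3)]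
    by (simp_all add: K_point_eq_exp cocycle_sum_eq_potential_diff \<phi>_def insert_commute[of w v])
  have "exp (- 2 * \<phi> v) * exp (\<phi> v - \<phi> w) = exp (- 2 * \<phi> w) * exp (\<phi> w - \<phi> v)"
    by (simp add: exp_add[symmetric])
  then show ?thesis
    by (simp add: k P)
qed

end

theorem theorem3:
  fixes V :: "'a set" and E :: "'a set set"
  assumes "ugraph V E"
    and "Digraph_Component.connected (with_proj (split_graph V E))"
  shows "(\<lambda>(s, t). K_point V E (cuts V) s t) ` (edge_params E \<times> cut_params (cuts V))
           = K_variety_pos V E
    \<and> (\<forall>P \<in> K_variety_pos V E. \<exists>!s. s \<in> edge_params E \<and>
         (\<exists>t \<in> cut_params (cuts V). P = K_point V E (cuts V) s t))
    \<and> (\<forall>s \<in> edge_params E. \<forall>s' \<in> edge_params E.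
         \<forall>t \<in> cut_params (cuts V). \<forall>t' \<in> cut_params (cuts V).
           K_point V E (cuts V) s t = K_point V E (cuts V) s' t' \<longleftrightarrow>
           s = s' \<and>
           (\<forall>a \<in> arcset V E. cocycle_transpose_mult V E (\<lambda>B. ln (t B) - ln (t' B)) a = 0))
    \<and> (\<forall>S. S \<subseteq> cuts V \<and> cocycle_row_basis V E S \<longrightarrow>
         bij_betw (\<lambda>(s, t). K_point V E S s t)
           (edge_params E \<times> cut_params S) (K_variety_pos V E))
    \<and> (\<forall>s \<in> edge_params E. \<forall>t \<in> cut_params (cuts V). \<forall>P \<kappa> c.
         P = K_point V E (cuts V) s t \<and>
         (\<forall>v \<in> V. \<kappa> v = c * (\<Prod>B \<in> {B \<in> cuts V. v \<in> B}. t B powi (-2))) \<longrightarrow>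
         (\<forall>(v, w) \<in> arcset V E. \<kappa> v * P (v, w) = \<kappa> w * P (w, v)))"
proof -
  interpret connected_split_graph V E
    using assms by unfold_locales
  note fin = finite_cuts
  have image: "(\<lambda>(s, t). K_point V E (cuts V) s t) ` (edge_params E \<times> cut_params (cuts V))
      = K_variety_pos V E"
    \<comment> \<open>The family of all cuts trivially spans the row space, hence
      \<open>refl\<close>.\<close>
    by (rule image_K_point[OF fin refl])
  have unique: "\<forall>P \<in> K_variety_pos V E. \<exists>!s. s \<in> edge_params E \<and>
      (\<exists>t \<in> cut_params (cuts V). P = K_point V E (cuts V) s t)"
  proof
    fix P assume "P \<in> K_variety_pos V E"
    then obtain s t where st: "s \<in> edge_params E" "t \<in> cut_params (cuts V)"
        "P = K_point V E (cuts V) s t"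
      using K_variety_pos_subset_image_K_point[OF fin refl] by blast
    then show "\<exists>!s. s \<in> edge_params E \<and>
        (\<exists>t \<in> cut_params (cuts V). P = K_point V E (cuts V) s t)"
      using K_point_eq_iff[OF fin] by (intro ex1I[of _ s]) blast+
  qed
  have balance: "\<forall>s \<in> edge_params E. \<forall>t \<in> cut_params (cuts V). \<forall>P \<kappa> c.
      P = K_point V E (cuts V) s t \<and>
      (\<forall>v \<in> V. \<kappa> v = c * (\<Prod>B \<in> {B \<in> cuts V. v \<in> B}. t B powi (-2))) \<longrightarrow>
      (\<forall>(v, w) \<in> arcset V E. \<kappa> v * P (v, w) = \<kappa> w * P (w, v))"
  proof safe
    fix s t \<kappa> c v w
    assume t: "t \<in> cut_params (cuts V)" and vw: "(v, w) \<in> arcset V E"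
      and \<kappa>: "\<forall>v \<in> V. \<kappa> v = c * (\<Prod>B \<in> {B \<in> cuts V. v \<in> B}. t B powi (-2))"
    show "\<kappa> v * K_point V E (cuts V) s t (v, w) = \<kappa> w * K_point V E (cuts V) s t (w, v)"
      \<comment> \<open>\<kappa> is prescribed on \<open>V\<close> only, which contains both
        endpoints; the constant \<open>c\<close> is then a common factor of both sides.\<close>
      unfolding bspec[OF \<kappa> arcD(1)[OF vw]] bspec[OF \<kappa> arcD(2)[OF vw]]
      by (simp only: mult.assoc detailed_balance[OF fin t vw])
  qed
  have confounded: "\<forall>s \<in> edge_params E. \<forall>s' \<in> edge_params E.
      \<forall>t \<in> cut_params (cuts V). \<forall>t' \<in> cut_params (cuts V).
        K_point V E (cuts V) s t = K_point V E (cuts V) s' t' \<longleftrightarrow>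
        s = s' \<and>
        (\<forall>a \<in> arcset V E. cocycle_transpose_mult V E (\<lambda>B. ln (t B) - ln (t' B)) a = 0)"
    unfolding cocycle_transpose_mult_def by (intro ballI K_point_eq_iff[OF fin])
  have basis: "\<forall>S. S \<subseteq> cuts V \<and> cocycle_row_basis V E S \<longrightarrow>
      bij_betw (\<lambda>(s, t). K_point V E S s t) (edge_params E \<times> cut_params S) (K_variety_pos V E)"
    using bij_betw_K_point by blast
  show ?thesis
    by (intro conjI image unique confounded basis balance)
qed

end
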